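(* Let $x$ be a reduced quadratic surd, let $[a_0,a_1,a_2,\dots]$ be its continued fraction expansion and $(\zeta_n)_{n\ge0}$ its sequence of complete quotients. Put $\alpha=-\frac{1}{x^*}$ (which is also a reduced quadratic surd) and write $\alpha=\frac{\sqrt N+p}{q}$, where $N$ is a positive integer which is not a perfect square, $p$ is a positive integer with $p^2<N$, $q$ is a positive integer dividing $N-p^2$, and $(p-q)^2<N<(p+q)^2$. Let $(y_n)_{n\ge0}$ and $(t_n)_{n\ge0}$ be the sequences of direction-change values and of step counts of the left-positive path (LPP) of $\alpha$ (not of $x$). Then, for every non-negative integer $n$: - $\zeta_n=-\frac{1}{y_n^*}$ if $n$ is even and $\zeta_n=-y_n^*$ if $n$ is odd; - $a_n=t_n$.
   Context: An irrational number $x$ is a reduced quadratic surd if $x$ is a root of a quadratic polynomial with integer coefficients, $x>1$, and its conjugate $x^*$ (the other root) satisfies $-1<x^*<0$. Every reduced quadratic surd can be written in the form $\frac{\sqrt N+p}{q}$ with $N,p,q$ as described in the claim. For rational numbers $a,b$, the algebraic conjugate of $a\sqrt N+b$ is $(a\sqrt N+b)^*=-a\sqrt N+b$. The (regular) continued fraction expansion of $x$ is defined by $\zeta_0=x$, $a_0=\lfloor\zeta_0\rfloor$ and, for every integer $n\ge0$, $\zeta_{n+1}=\frac{1}{\zeta_n-a_n}$, $a_{n+1}=\lfloor\zeta_{n+1}\rfloor$; the $\zeta_n$ are the complete quotients. The Calkin-Wilf tree of $\alpha$ is the infinite binary tree whose root is labeled $\alpha$ and in which every vertex labeled $z$ has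 a left child labeled $\frac{z}{z+1}$ and a right child labeled $z+1$ (since $\alpha>0$, all labels are positive). Each vertex carries a triple $(\varepsilon,c,d)$ with $\varepsilon\in\{-1,1\}$, $c$ an integer, $d$ a positive integer dividing $N-c^2$, and label equal to $\frac{\varepsilon\sqrt N+c}{d}$, defined as follows. The root has triple $(1,p,q)$. If a vertex has triple $(\varepsilon,c,d)$, its right child has triple $(\varepsilon,c+d,d)$; its left child has triple $\left(-\varepsilon,\frac{N-c^2}{d}-c,\frac{N-(c+d)^2}{d}\right)$ if $N-(c+d)^2>0$, and $\left(\varepsilon,c-\frac{N-c^2}{d},\frac{(c+d)^2-N}{d}\right)$ otherwise. The left-positive path (LPP) of $\alpha$ is the infinite descending path which starts at the root and which, from each vertex, goes to the left child if the value of $\varepsilon$ for that left child is $1$, and to the right child otherwise. $x_n$ denotes the label of the $n$-th vertex of the LPP, with $x_0=\alpha$. Put $s_n=\ell$ if the step from $x_n$ to $x_{n+1}$ goes to the left child, and $s_n=r$ if it goes to the right child. Direction changes: put $\varphi(0)=0$ and, for $n\ge0$, let $\varphi(n+1)$ be the least integer $k>\varphi(n)$ with $s_{k-1}\ne s_k$ (such $k$ always exists). Put $y_n=x_{\varphi(n)}$ and $t_n=\varphi(n+1)-\varphi(n)$. *)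

theory Defs
  imports Complex_Main "HOL-Computational_Algebra.Nth_Powers"
begin

text \<open>
  The conjugate of a quadratic irrational is the other root of an integer quadratic polynomial
  vanishing at it; an irrational number determines that polynomial up to a rational factor.
\<close>

definition quad_conj :: "real \<Rightarrow> real" where
  "quad_conj x = (THE y. y \<noteq> x \<and> (\<exists>a b c :: int. a \<noteq> 0 \<and>
     of_int a * x\<^sup>2 + of_int b * x + of_int c = 0 \<and>
     of_int a * y\<^sup>2 + of_int b * y + of_int c = 0))"

definition reduced_quadratic_surd :: "real \<Rightarrow> bool" where
  "reduced_quadratic_surd x \<longleftrightarrow>
     x \<notin> \<rat> \<and>
     (\<exists>a b c :: int. a \<noteq> 0 \<and> of_int a * x\<^sup>2 + of_int b * x + of_int c = 0) \<and>
     x > 1 \<and> -1 < quad_conj x \<and> quad_conj x < 0"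

text \<open>
  The conjugation \<open>a \<surd>N + b \<mapsto> - a \<surd>N + b\<close>, for rational \<open>a\<close> and \<open>b\<close>. It is meaningful for
  nonsquare \<open>N\<close> and arguments of that form, where \<open>a\<close> and \<open>b\<close> are unique.
\<close>

definition surd_conj :: "int \<Rightarrow> real \<Rightarrow> real" where
  "surd_conj N z = (THE w. \<exists>a b :: rat.
     z = of_rat a * sqrt (of_int N) + of_rat b \<and>
     w = - of_rat a * sqrt (of_int N) + of_rat b)"

lemma sqrt_nonsquare_irrational:
  assumes "N > 0" and "\<not> is_square (N :: int)"
  shows "sqrt (of_int N) \<notin> \<rat>"
proof
  assume "sqrt (of_int N) \<in> \<rat>"
  then obtain m n :: int where mn: "n > 0" "coprime m n" "sqrt (of_int N) = of_int m / of_int n"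
    by (rule Rats_cases')
  have "of_int N = (of_int m / of_int n :: real)\<^sup>2"
    using mn(3) assms(1) by (metis of_int_0_le_iff less_imp_le real_sqrt_pow2)
  hence "(of_int (N * n\<^sup>2) :: real) = of_int (m\<^sup>2)"
    using mn(1) by (simp add: field_simps)
  hence eq: "N * n\<^sup>2 = m\<^sup>2" by (simp only: of_int_eq_iff)
  hence "n dvd m\<^sup>2" by (metis dvd_triv_right dvd_mult power2_eq_square)
  moreover have "coprime n (m\<^sup>2)" using mn(2) by (simp add: coprime_commute)
  ultimately have "is_unit n" by (metis coprime_common_divisor dvd_refl)
  hence "n = 1" using mn(1) by simp
  hence "N = m\<^sup>2" using eq by simp
  thus False using assms(2) by (auto simp: is_nth_power_def)
qed

lemma surd_conj_eq:
  fixes a b :: rat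
  assumes "N > 0" and "\<not> is_square N"
  shows "surd_conj N (of_rat a * sqrt (of_int N) + of_rat b) =
           - of_rat a * sqrt (of_int N) + of_rat b"
  unfolding surd_conj_def
proof (rule the_equality)
  fix w :: real
  assume "\<exists>a' b'. of_rat a * sqrt (of_int N) + of_rat b = of_rat a' * sqrt (of_int N) + of_rat b' \<and>
            w = - of_rat a' * sqrt (of_int N) + of_rat b'"
  then obtain a' b' where
    eq: "of_rat a * sqrt (of_int N) + of_rat b = of_rat a' * sqrt (of_int N) + of_rat b'" and
    w: "w = - of_rat a' * sqrt (of_int N) + of_rat b'" by blast
  have "a = a'"
  proof (rule ccontr)
    assume ne: "a \<noteq> a'"
    have "of_rat (a - a') * sqrt (of_int N) = of_rat (b' - b)"
      using eq by (simp add: of_rat_diff algebra_simps)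
    hence "sqrt (of_int N) = of_rat ((b' - b) / (a - a'))"
      using ne by (simp add: of_rat_divide of_rat_diff field_simps)
    hence "sqrt (of_int N) \<in> \<rat>" by simp
    thus False using sqrt_nonsquare_irrational[OF assms] by blast
  qed
  moreover from this have "b = b'" using eq by simp
  ultimately show "w = - of_rat a * sqrt (of_int N) + of_rat b" using w by simp
qed blast

lemma quad_conj_eq:
  fixes a b c :: int
  assumes irr: "x \<notin> \<rat>" and a: "a \<noteq> 0"
    and root: "of_int a * x\<^sup>2 + of_int b * x + of_int c = 0"
  shows "quad_conj x = - (of_int b / of_int a) - x"
  unfolding quad_conj_def
proof (rule the_equality)
  have "of_int a * (- (of_int b / of_int a) - x)\<^sup>2 + of_int b * (- (of_int b / of_int a) - x) + of_int c
      = of_int a * x\<^sup>2 + of_int b * x + of_int c"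
    using a by (simp add: field_simps power2_eq_square)
  moreover have "- (of_int b / of_int a) - x \<noteq> x"
  proof
    assume "- (of_int b / of_int a) - x = x"
    hence "x = - (of_int b / of_int a) / 2" by simp
    hence "x \<in> \<rat>" by simp
    thus False using irr by blast
  qed
  ultimately show "- (of_int b / of_int a) - x \<noteq> x \<and> (\<exists>a' b' c' :: int. a' \<noteq> 0 \<and>
      of_int a' * x\<^sup>2 + of_int b' * x + of_int c' = 0 \<and>
      of_int a' * (- (of_int b / of_int a) - x)\<^sup>2 + of_int b' * (- (of_int b / of_int a) - x) + of_int c' = 0)"
    using a root by metis
next
  fix y :: real
  assume "y \<noteq> x \<and> (\<exists>a' b' c' :: int. a' \<noteq> 0 \<and>
      of_int a' * x\<^sup>2 + of_int b' * x + of_int c' = 0 \<and>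
      of_int a' * y\<^sup>2 + of_int b' * y + of_int c' = 0)"
  then obtain a' b' c' :: int where y: "y \<noteq> x" "a' \<noteq> 0"
    and rx: "of_int a' * x\<^sup>2 + of_int b' * x + of_int c' = 0"
    and ry: "of_int a' * y\<^sup>2 + of_int b' * y + of_int c' = 0" by blast
  have "(y - x) * (of_int a' * (y + x) + of_int b') = 0"
    using rx ry by (simp add: algebra_simps power2_eq_square)
  hence sum': "of_int a' * (y + x) + of_int b' = 0" using y(1) by simp
  have "of_int a' * (of_int a * x\<^sup>2 + of_int b * x + of_int c)
      - of_int a * (of_int a' * x\<^sup>2 + of_int b' * x + of_int c') = 0"
    using root rx by simp
  hence lin: "of_int (a' * b - a * b') * x = of_int (a * c' - a' * c)"
    by (simp add: algebra_simps)
  have "a' * b - a * b' = 0"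
  proof (rule ccontr)
    assume ne: "a' * b - a * b' \<noteq> 0"
    hence "(of_int (a' * b - a * b') :: real) \<noteq> 0" by (simp only: of_int_eq_0_iff not_False_eq_True)
    hence "x = of_int (a * c' - a' * c) / of_int (a' * b - a * b')"
      using lin by (metis nonzero_mult_div_cancel_left)
    hence "x \<in> \<rat>" by (metis Rats_divide Rats_of_int)
    thus False using irr by blast
  qed
  hence ratio: "(of_int a' * of_int b :: real) = of_int a * of_int b'"
    by (metis eq_iff_diff_eq_0 of_int_mult)
  have "of_int a' * (of_int a * (y + x) + of_int b) = of_int a * (of_int a' * (y + x) + of_int b')"
    using ratio by (simp add: algebra_simps)
  hence "of_int a * (y + x) + of_int b = 0" using sum' y(2) by simp
  thus "y = - (of_int b / of_int a) - x" using a by (simp add: field_simps)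
qed


primrec complete_quotient :: "real \<Rightarrow> nat \<Rightarrow> real" where
  "complete_quotient x 0 = x"
| "complete_quotient x (Suc n) =
     1 / (complete_quotient x n - of_int \<lfloor>complete_quotient x n\<rfloor>)"

definition partial_quotient :: "real \<Rightarrow> nat \<Rightarrow> int" where
  "partial_quotient x n = \<lfloor>complete_quotient x n\<rfloor>"


text \<open>
  A vertex of the Calkin-Wilf tree is the list of the steps leading to it from the root, the
  \<^emph>\<open>last\<close> step first: \<open>s # v\<close> is the child of \<open>v\<close> in direction \<open>s\<close>.
\<close>

datatype direction = Leftward | Rightward

type_synonym vertex = "direction list"

fun cw_label :: "real \<Rightarrow> vertex \<Rightarrow> real" where
  "cw_label \<alpha> [] = \<alpha>"
| "cw_label \<alpha> (Leftward # v) = cw_label \<alpha> v / (cw_label \<alpha> v + 1)"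
| "cw_label \<alpha> (Rightward # v) = cw_label \<alpha> v + 1"

text \<open>
  All integer divisions below are exact, since \<open>d\<close> divides \<open>N - c\<^sup>2\<close> at every vertex.
\<close>

fun left_triple :: "int \<Rightarrow> int \<times> int \<times> int \<Rightarrow> int \<times> int \<times> int" where
  "left_triple N (\<epsilon>, c, d) =
     (if N - (c + d)\<^sup>2 > 0
      then (- \<epsilon>, (N - c\<^sup>2) div d - c, (N - (c + d)\<^sup>2) div d)
      else (\<epsilon>, c - (N - c\<^sup>2) div d, ((c + d)\<^sup>2 - N) div d))"

fun right_triple :: "int \<times> int \<times> int \<Rightarrow> int \<times> int \<times> int" where
  "right_triple (\<epsilon>, c, d) = (\<epsilon>, c + d, d)"

fun cw_triple :: "int \<Rightarrow> int \<Rightarrow> int \<Rightarrow> vertex \<Rightarrow> int \<times> int \<times> int" where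
  "cw_triple N p q [] = (1, p, q)"
| "cw_triple N p q (Leftward # v) = left_triple N (cw_triple N p q v)"
| "cw_triple N p q (Rightward # v) = right_triple (cw_triple N p q v)"

definition vertex_sign :: "int \<Rightarrow> int \<Rightarrow> int \<Rightarrow> vertex \<Rightarrow> int" where
  "vertex_sign N p q v = fst (cw_triple N p q v)"


definition lpp_direction :: "int \<Rightarrow> int \<Rightarrow> int \<Rightarrow> vertex \<Rightarrow> direction" where
  "lpp_direction N p q v =
     (if vertex_sign N p q (Leftward # v) = 1 then Leftward else Rightward)"

primrec lpp_vertex :: "int \<Rightarrow> int \<Rightarrow> int \<Rightarrow> nat \<Rightarrow> vertex" where
  "lpp_vertex N p q 0 = []"
| "lpp_vertex N p q (Suc n) = lpp_direction N p q (lpp_vertex N p q n) # lpp_vertex N p q n"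

definition lpp_step :: "int \<Rightarrow> int \<Rightarrow> int \<Rightarrow> nat \<Rightarrow> direction" where
  "lpp_step N p q n = lpp_direction N p q (lpp_vertex N p q n)"

definition lpp_label :: "int \<Rightarrow> int \<Rightarrow> int \<Rightarrow> nat \<Rightarrow> real" where
  "lpp_label N p q n =
     cw_label ((sqrt (of_int N) + of_int p) / of_int q) (lpp_vertex N p q n)"

primrec turn_index :: "int \<Rightarrow> int \<Rightarrow> int \<Rightarrow> nat \<Rightarrow> nat" where
  "turn_index N p q 0 = 0"
| "turn_index N p q (Suc n) =
     (LEAST k. k > turn_index N p q n \<and> lpp_step N p q (k - 1) \<noteq> lpp_step N p q k)"

definition turn_value :: "int \<Rightarrow> int \<Rightarrow> int \<Rightarrow> nat \<Rightarrow> real" where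
  "turn_value N p q n = lpp_label N p q (turn_index N p q n)"

definition turn_count :: "int \<Rightarrow> int \<Rightarrow> int \<Rightarrow> nat \<Rightarrow> int" where
  "turn_count N p q n = int (turn_index N p q (Suc n)) - int (turn_index N p q n)"

end

theory Submission
  imports Defs
begin

text \<open>
  The path keeps \<open>\<epsilon> = 1\<close>, so its labels are \<open>z = (\<surd>N + c) / d\<close>, and \<open>w = - z\<^sup>*\<close> stays positive.
  It turns right exactly when \<open>w > 1\<close>, replacing \<open>w\<close> by \<open>w - 1\<close>, and otherwise left,
  replacing \<open>1 / w\<close> by \<open>1 / w - 1\<close>. This is the subtractive form of the continued fraction
  algorithm, and it starts at \<open>w = 1 / x\<close>. Hence between two changes of direction it
  subtracts \<open>1\<close> from \<open>\<zeta>\<^sub>n\<close> exactly \<open>a\<^sub>n\<close> times, alternately on \<open>1 / w\<close> and on \<open>w\<close>.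
\<close>

section \<open>Conjugates of surds with integer parameters\<close>

definition lpp_neg_conj :: "int \<Rightarrow> int \<Rightarrow> int \<Rightarrow> nat \<Rightarrow> real" where
  "lpp_neg_conj N p q n = - surd_conj N (lpp_label N p q n)"

lemma surd_conj_fraction:
  assumes "N > 0" "\<not> is_square N"
  shows "surd_conj N ((sqrt (of_int N) + of_int c) / of_int d) =
    (of_int c - sqrt (of_int N)) / of_int d"
proof -
  have "of_rat (1 / of_int d) = (1 / of_int d :: real)"
    and "of_rat (of_int c / of_int d) = (of_int c / of_int d :: real)"
    by (simp_all add: of_rat_divide)
  then show ?thesis
    using surd_conj_eq[OF assms, of "1 / of_int d" "of_int c / of_int d"]
    by (simp add: add_divide_distrib diff_divide_distrib)
qed

lemma abs_less_sqrt_iff: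
  "\<bar>real_of_int c\<bar> < sqrt (of_int N) \<longleftrightarrow> c\<^sup>2 < N"
proof -
  have "\<bar>real_of_int c\<bar> < sqrt (of_int N) \<longleftrightarrow> sqrt ((of_int c)\<^sup>2) < sqrt (of_int N)"
    by simp
  also have "\<dots> \<longleftrightarrow> real_of_int (c\<^sup>2) < of_int N"
    by (simp only: real_sqrt_less_iff of_int_power)
  finally show ?thesis by (simp only: of_int_less_iff)
qed

section \<open>The invariant of the path and the effect of one step\<close>

locale lpp_root =
  fixes N p q :: int
  assumes N_pos: "N > 0" and nonsquare: "\<not> is_square N"
    and p_sq: "p\<^sup>2 < N" and q_pos: "q > 0" and q_dvd: "q dvd N - p\<^sup>2"
begin

lemma square_neq_N: "c\<^sup>2 \<noteq> N"
  using nonsquare by (auto simp: is_nth_power_def)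

text \<open>By \<open>left_triple\<close>, the left child of a vertex of sign 1 has sign -1 exactly
  when (c + d)^2 < N. Since c > - sqrt N and d > 0, this means c + d < sqrt N, that is, w > 1 for w
  = (sqrt N - c) / d. The last clause of each case is the conjugate of the label rule, z + 1 or z /
  (z + 1).\<close>

lemma lpp_step_cases:
  assumes triple: "cw_triple N p q v = (1, c, d)"
    and label: "cw_label ((sqrt (of_int N) + of_int p) / of_int q) v
      = (sqrt (of_int N) + of_int c) / of_int d"
    and d: "d > 0" "d dvd N - c\<^sup>2" and c: "c\<^sup>2 < N"
  obtains (right) c' d' where "lpp_direction N p q v = Rightward"
      "cw_triple N p q (Rightward # v) = (1, c', d')"
      "cw_label ((sqrt (of_int N) + of_int p) / of_int q) (Rightward # v)
        = (sqrt (of_int N) + of_int c') / of_int d'"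
      "d' > 0" "d' dvd N - c'\<^sup>2" "c'\<^sup>2 < N"
      "(sqrt (of_int N) - of_int c) / of_int d > 1"
      "(sqrt (of_int N) - of_int c') / of_int d' = (sqrt (of_int N) - of_int c) / of_int d - 1"
  | (left) c' d' where "lpp_direction N p q v = Leftward"
      "cw_triple N p q (Leftward # v) = (1, c', d')"
      "cw_label ((sqrt (of_int N) + of_int p) / of_int q) (Leftward # v)
        = (sqrt (of_int N) + of_int c') / of_int d'"
      "d' > 0" "d' dvd N - c'\<^sup>2" "c'\<^sup>2 < N"
      "(sqrt (of_int N) - of_int c) / of_int d < 1"
      "of_int d' / (sqrt (of_int N) - of_int c') = of_int d / (sqrt (of_int N) - of_int c) - 1"
proof -
  define s where "s = sqrt (real_of_int N)"
  have s_sq: "s * s = of_int N"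
    using N_pos by (simp add: s_def)
  have c_less: "\<bar>of_int c\<bar> < s"
    using c unfolding s_def by (simp only: abs_less_sqrt_iff)
  show thesis
  proof (cases "(c + d)\<^sup>2 < N")
    case True
    have "\<bar>real_of_int (c + d)\<bar> < s"
      using True unfolding s_def by (simp only: abs_less_sqrt_iff)
    then have "of_int c + of_int d < s" by simp
    moreover have "d dvd N - (c + d)\<^sup>2"
    proof -
      have "N - (c + d)\<^sup>2 = N - c\<^sup>2 - d * (2 * c + d)"
        by (simp add: power2_eq_square algebra_simps)
      then show ?thesis using d(2) by (metis dvd_diff dvd_triv_left)
    qed
    ultimately show thesis
      using d(1) True triple label
      by (intro right[of "c + d" d])
        (auto simp: lpp_direction_def vertex_sign_def s_def field_simps)
  next
    case False
    then have gt: "(c + d)\<^sup>2 > N" using square_neq_N[of "c + d"] by linarith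
    \<comment> \<open>The left child is now (1, c - e, d') with d' = ((c + d)^2 - N) / d. The
      factorisations d * d' = (c + d)^2 - N and d' * e = N - (c - e)^2 give positivity, divisibility
      and the bound on c - e.\<close>
    obtain e where e: "N - c\<^sup>2 = d * e" using d(2) by blast
    define d' where "d' = 2 * c + d - e"
    have dd': "(c + d)\<^sup>2 - N = d * d'"
      using e by (simp add: d'_def power2_eq_square algebra_simps)
    have e_pos: "e > 0" using e c d(1) by (metis diff_gt_0_iff_gt zero_less_mult_pos)
    have d'_pos: "d' > 0" using dd' gt d(1) by (metis diff_gt_0_iff_gt zero_less_mult_pos)
    have N': "N - (c - e)\<^sup>2 = d' * e"
      using e by (simp add: d'_def power2_eq_square algebra_simps)
    have c'_sq: "(c - e)\<^sup>2 < N"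
      using N' mult_pos_pos[OF d'_pos e_pos] by linarith
    have c'_less: "\<bar>real_of_int (c - e)\<bar> < s"
      using c'_sq unfolding s_def by (simp only: abs_less_sqrt_iff)
    have "\<not> \<bar>real_of_int (c + d)\<bar> < s"
      using False unfolding s_def by (simp only: abs_less_sqrt_iff) simp
    then have ge: "of_int c + of_int d \<ge> s"
      using c_less d(1) by (auto simp: abs_less_iff)
    moreover have "of_int c + of_int d \<noteq> s"
    proof
      assume "of_int c + of_int d = s"
      then have "real_of_int ((c + d)\<^sup>2) = of_int N"
        using s_sq by (simp add: power2_eq_square)
      then show False using gt by (simp only: of_int_eq_iff)
    qed
    ultimately have less: "s < of_int c + of_int d" by simp
    have real_e: "s * s - of_int c * of_int c = of_int d * of_int e"
      using arg_cong[OF e, of real_of_int] s_sq by (simp add: power2_eq_square)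
    have real_d': "(of_int d' :: real) = 2 * of_int c + of_int d - of_int e"
      by (simp add: d'_def)
    have nz: "real_of_int d \<noteq> 0" "real_of_int d' \<noteq> 0" "s + of_int c + of_int d \<noteq> 0"
      "s - of_int c \<noteq> 0" "s - of_int (c - e) \<noteq> 0"
      using d(1) d'_pos c_less c'_less by auto
    \<comment> \<open>The label rule z / (z + 1) for the left child, cross-multiplied.\<close>
    have "(s + of_int c) * of_int d' = (s + of_int (c - e)) * (s + of_int c + of_int d)"
      using real_e unfolding real_d' of_int_diff by algebra
    then have label': "((s + of_int c) / of_int d) / ((s + of_int c) / of_int d + 1)
        = (s + of_int (c - e)) / of_int d'"
      using nz by (simp add: divide_simps)
    \<comment> \<open>The previous identity with - s in place of s, which is its conjugate.\<close>
    have "of_int d' * (s - of_int c) = (of_int d - (s - of_int c)) * (s - of_int (c - e))"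
      using real_e unfolding real_d' of_int_diff by algebra
    then have conj': "of_int d' / (s - of_int (c - e)) = of_int d / (s - of_int c) - 1"
      using nz by (simp add: divide_simps)
    show thesis
    proof (rule left[of "c - e" d'])
      show "cw_triple N p q (Leftward # v) = (1, c - e, d')"
        using False d(1) triple e dd' by simp
      then show "lpp_direction N p q v = Leftward"
        by (simp add: lpp_direction_def vertex_sign_def)
      show "cw_label ((sqrt (of_int N) + of_int p) / of_int q) (Leftward # v)
          = (sqrt (of_int N) + of_int (c - e)) / of_int d'"
        using label label' by (simp add: s_def)
      show "d' dvd N - (c - e)\<^sup>2" using N' by simp
      show "(sqrt (of_int N) - of_int c) / of_int d < 1"
        using less d(1) by (simp add: s_def field_simps)
      show "of_int d' / (sqrt (of_int N) - of_int (c - e))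
          = of_int d / (sqrt (of_int N) - of_int c) - 1"
        using conj' by (simp add: s_def)
    qed (fact d'_pos c'_sq)+
  qed
qed

text \<open>A left step is taken only towards sign 1, and a right step keeps the sign. The
  conditions on c and d are those that \<open>lpp_step_cases\<close> consumes and reproduces: exact
  division and |c| < sqrt N.\<close>

lemma lpp_vertex_triple:
  "\<exists>c d. cw_triple N p q (lpp_vertex N p q n) = (1, c, d) \<and>
    lpp_label N p q n = (sqrt (of_int N) + of_int c) / of_int d \<and>
    d > 0 \<and> d dvd N - c\<^sup>2 \<and> c\<^sup>2 < N"
proof (induction n)
  case 0
  show ?case using q_pos q_dvd p_sq by (auto simp: lpp_label_def)
next
  case (Suc n)
  then obtain c d where "cw_triple N p q (lpp_vertex N p q n) = (1, c, d)"
    "cw_label ((sqrt (of_int N) + of_int p) / of_int q) (lpp_vertex N p q n)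
      = (sqrt (of_int N) + of_int c) / of_int d"
    "d > 0" "d dvd N - c\<^sup>2" "c\<^sup>2 < N"
    unfolding lpp_label_def by blast
  then show ?case
    by (cases rule: lpp_step_cases) (simp_all add: lpp_label_def)
qed

lemma lpp_neg_conj_eq:
  assumes "lpp_label N p q n = (sqrt (of_int N) + of_int c) / of_int d"
  shows "lpp_neg_conj N p q n = (sqrt (of_int N) - of_int c) / of_int d"
  using surd_conj_fraction[OF N_pos nonsquare, of c d] assms
  by (simp add: lpp_neg_conj_def minus_divide_left)

text \<open>Eliminates the triple: step counting below knows the steps only through this lemma and
  positivity of w. Reciprocals in the left case make both kinds of step a subtraction of 1.\<close>

lemma lpp_step_neg_conj:
  obtains (right) "lpp_step N p q n = Rightward" "lpp_neg_conj N p q n > 1"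
      "lpp_neg_conj N p q (Suc n) = lpp_neg_conj N p q n - 1"
  | (left) "lpp_step N p q n = Leftward" "lpp_neg_conj N p q n < 1"
      "1 / lpp_neg_conj N p q (Suc n) = 1 / lpp_neg_conj N p q n - 1"
proof -
  obtain c d where triple: "cw_triple N p q (lpp_vertex N p q n) = (1, c, d)"
    and label: "cw_label ((sqrt (of_int N) + of_int p) / of_int q) (lpp_vertex N p q n)
      = (sqrt (of_int N) + of_int c) / of_int d"
    and cd: "d > 0" "d dvd N - c\<^sup>2" "c\<^sup>2 < N"
    using lpp_vertex_triple[of n] unfolding lpp_label_def by blast
  have w: "lpp_neg_conj N p q n = (sqrt (of_int N) - of_int c) / of_int d"
    using label by (intro lpp_neg_conj_eq) (simp add: lpp_label_def)
  from triple label cd show thesis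
  proof (cases rule: lpp_step_cases)
    case R: (right c' d')
    have "lpp_neg_conj N p q (Suc n) = (sqrt (of_int N) - of_int c') / of_int d'"
      using R(1,3) by (intro lpp_neg_conj_eq) (simp add: lpp_label_def)
    with R w show thesis by (intro right) (simp_all add: lpp_step_def)
  next
    case L: (left c' d')
    have "lpp_neg_conj N p q (Suc n) = (sqrt (of_int N) - of_int c') / of_int d'"
      using L(1,3) by (intro lpp_neg_conj_eq) (simp add: lpp_label_def)
    with L w show thesis by (intro left) (simp_all add: lpp_step_def)
  qed
qed

lemma lpp_neg_conj_pos: "lpp_neg_conj N p q n > 0"
proof -
  obtain c d where "lpp_label N p q n = (sqrt (of_int N) + of_int c) / of_int d"
    "d > 0" "c\<^sup>2 < N"
    using lpp_vertex_triple[of n] by blast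
  moreover from this have "\<bar>of_int c\<bar> < sqrt (of_int N)"
    by (simp only: abs_less_sqrt_iff)
  ultimately show ?thesis by (simp add: lpp_neg_conj_eq)
qed

section \<open>Runs of equal steps\<close>

text \<open>Turns the \<open>LEAST\<close> in \<open>turn_index\<close> into a run length. A turn at
  k compares steps k - 1 and k with k > m, so both lie inside the block as long as k < m +
  a.\<close>

lemma Least_turn:
  assumes "a > 0" and const: "\<And>i. i < a \<Longrightarrow> lpp_step N p q (m + i) = s"
    and turn: "lpp_step N p q (m + a) \<noteq> s"
  shows "(LEAST k. k > m \<and> lpp_step N p q (k - 1) \<noteq> lpp_step N p q k) = m + a"
proof (rule Least_equality)
  show "m + a > m \<and> lpp_step N p q (m + a - 1) \<noteq> lpp_step N p q (m + a)"
    using assms(1) const[of "a - 1"] turn by auto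
next
  fix k assume k: "k > m \<and> lpp_step N p q (k - 1) \<noteq> lpp_step N p q k"
  show "m + a \<le> k"
  proof (rule ccontr)
    assume "\<not> m + a \<le> k"
    then show False using k const[of "k - 1 - m"] const[of "k - m"] by auto
  qed
qed

text \<open>Right steps subtract 1 from w until its fractional part is left. That part is below 1,
  so the next step goes left and the run ends.\<close>

lemma lpp_right_run:
  assumes z: "lpp_neg_conj N p q m = z" "z > 1" "z \<notin> \<int>"
  shows "(LEAST k. k > m \<and> lpp_step N p q (k - 1) \<noteq> lpp_step N p q k) = m + nat \<lfloor>z\<rfloor>"
    and "lpp_neg_conj N p q (m + nat \<lfloor>z\<rfloor>) = z - of_int \<lfloor>z\<rfloor>"
proof -
  \<comment> \<open>The bound on i is inclusive, so that the value after the last step is covered.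
    Before each step z - i \<ge> 1, which excludes a left step.\<close>
  have "int i \<le> \<lfloor>z\<rfloor> \<Longrightarrow> lpp_neg_conj N p q (m + i) = z - of_nat i" for i
  proof (induction i)
    case (Suc i)
    then have "lpp_neg_conj N p q (m + i) = z - of_nat i" by simp
    moreover have "z \<noteq> of_int (int (Suc i))" using z(3) by (metis Ints_of_int)
    ultimately show ?case
      using Suc.prems by (cases rule: lpp_step_neg_conj[of "m + i"]) (simp_all add: le_floor_iff)
  qed (simp add: z)
  note run = this
  have f: "int (nat \<lfloor>z\<rfloor>) = \<lfloor>z\<rfloor>" "\<lfloor>z\<rfloor> \<ge> 1" using z(2) by (auto simp: le_floor_iff)
  show w: "lpp_neg_conj N p q (m + nat \<lfloor>z\<rfloor>) = z - of_int \<lfloor>z\<rfloor>"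
    using run[of "nat \<lfloor>z\<rfloor>"] f by (metis of_int_of_nat_eq order_refl)
  show "(LEAST k. k > m \<and> lpp_step N p q (k - 1) \<noteq> lpp_step N p q k) = m + nat \<lfloor>z\<rfloor>"
  proof (rule Least_turn)
    show "nat \<lfloor>z\<rfloor> > 0" using f by simp
    show "lpp_step N p q (m + i) = Rightward" if "i < nat \<lfloor>z\<rfloor>" for i
    proof (cases rule: lpp_step_neg_conj[of "m + i"])
      case left
      moreover have "int (Suc i) \<le> \<lfloor>z\<rfloor>" using that by simp
      ultimately show ?thesis using run[of i] by (simp add: le_floor_iff)
    qed
    show "lpp_step N p q (m + nat \<lfloor>z\<rfloor>) \<noteq> Rightward"
      using w by (cases rule: lpp_step_neg_conj[of "m + nat \<lfloor>z\<rfloor>"]) (simp_all, linarith)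
  qed
qed

text \<open>The mirror image of \<open>lpp_right_run\<close> with 1 / w for w; positivity of w
  carries the comparisons with 1 over to the reciprocal.\<close>

lemma lpp_left_run:
  assumes z: "1 / lpp_neg_conj N p q m = z" "z > 1" "z \<notin> \<int>"
  shows "(LEAST k. k > m \<and> lpp_step N p q (k - 1) \<noteq> lpp_step N p q k) = m + nat \<lfloor>z\<rfloor>"
    and "1 / lpp_neg_conj N p q (m + nat \<lfloor>z\<rfloor>) = z - of_int \<lfloor>z\<rfloor>"
proof -
  have gt: "lpp_neg_conj N p q k > 1 \<longleftrightarrow> 1 / lpp_neg_conj N p q k < 1"
    and lt: "lpp_neg_conj N p q k < 1 \<longleftrightarrow> 1 / lpp_neg_conj N p q k > 1" for k
    using lpp_neg_conj_pos[of k] by (simp_all add: field_simps)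
  have "int i \<le> \<lfloor>z\<rfloor> \<Longrightarrow> 1 / lpp_neg_conj N p q (m + i) = z - of_nat i" for i
  proof (induction i)
    case (Suc i)
    then have w: "1 / lpp_neg_conj N p q (m + i) = z - of_nat i" by simp
    have "real (Suc i) \<le> z" using Suc.prems by (simp add: le_floor_iff)
    then have "\<not> lpp_neg_conj N p q (m + i) > 1" unfolding gt w by simp
    with w show ?case
      by (cases rule: lpp_step_neg_conj[of "m + i"]) simp_all
  qed (simp add: z)
  note run = this
  have f: "int (nat \<lfloor>z\<rfloor>) = \<lfloor>z\<rfloor>" "\<lfloor>z\<rfloor> \<ge> 1" using z(2) by (auto simp: le_floor_iff)
  show w: "1 / lpp_neg_conj N p q (m + nat \<lfloor>z\<rfloor>) = z - of_int \<lfloor>z\<rfloor>"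
    using run[of "nat \<lfloor>z\<rfloor>"] f by (metis of_int_of_nat_eq order_refl)
  show "(LEAST k. k > m \<and> lpp_step N p q (k - 1) \<noteq> lpp_step N p q k) = m + nat \<lfloor>z\<rfloor>"
  proof (rule Least_turn)
    show "nat \<lfloor>z\<rfloor> > 0" using f by simp
    show "lpp_step N p q (m + i) = Leftward" if "i < nat \<lfloor>z\<rfloor>" for i
    proof (cases rule: lpp_step_neg_conj[of "m + i"])
      case right
      moreover have "int (Suc i) \<le> \<lfloor>z\<rfloor>" using that by simp
      ultimately show ?thesis using run[of i] gt[of "m + i"] unfolding le_floor_iff by simp
    qed
    have "\<not> 1 / lpp_neg_conj N p q (m + nat \<lfloor>z\<rfloor>) > 1" unfolding w by linarith
    then show "lpp_step N p q (m + nat \<lfloor>z\<rfloor>) \<noteq> Leftward"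
      unfolding lt[symmetric] by (cases rule: lpp_step_neg_conj[of "m + nat \<lfloor>z\<rfloor>"]) simp_all
  qed
qed

end

section \<open>Complete quotients of an irrational number\<close>

lemma complete_quotient_irrational:
  assumes "x \<notin> \<rat>"
  shows "complete_quotient x n \<notin> \<rat>"
proof (induction n)
  case (Suc n)
  define z where "z = complete_quotient x n"
  have "z \<in> \<rat>" if "1 / (z - of_int \<lfloor>z\<rfloor>) \<in> \<rat>"
  proof -
    \<comment> \<open>This undoes one step of the expansion and recovers z; as
      \<open>1 / 0 = 0\<close>, it does so even for an integer z.\<close>
    have "inverse (1 / (z - of_int \<lfloor>z\<rfloor>)) + of_int \<lfloor>z\<rfloor> \<in> \<rat>"
      by (intro Rats_add Rats_inverse that) simp
    then show ?thesis by simp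
  qed
  with Suc show ?case by (auto simp: z_def)
qed (use assms in simp)

text \<open>Past the start, each quotient is the reciprocal of a fractional part, which
  irrationality keeps away from 0. This provides the bound \<open>z > 1\<close> of the run
  lemmas.\<close>

lemma complete_quotient_gt_1:
  assumes "x \<notin> \<rat>" "x > 1"
  shows "complete_quotient x n > 1"
proof (cases n)
  case (Suc m)
  define z where "z = complete_quotient x m"
  have "z \<noteq> of_int \<lfloor>z\<rfloor>"
    using complete_quotient_irrational[OF assms(1), of m] by (metis Rats_of_int z_def)
  then have "z - of_int \<lfloor>z\<rfloor> > 0" by linarith
  moreover have "z - of_int \<lfloor>z\<rfloor> < 1" by linarith
  ultimately show ?thesis unfolding Suc by (simp add: z_def field_simps)
qed (use assms in simp)

section \<open>Turns of the path and complete quotients\<close>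

context lpp_root
begin

text \<open>The two claims need each other in the induction: the value at turn n fixes the length of
  the run that starts there, and the fractional part left at its end is the reciprocal of the next
  complete quotient. Taking that reciprocal exchanges w and 1 / w, hence the parity.\<close>

lemma lpp_complete_quotient:
  assumes "x \<notin> \<rat>" "x > 1" "1 / lpp_neg_conj N p q 0 = x"
  shows "complete_quotient x n =
      (if even n then 1 / lpp_neg_conj N p q (turn_index N p q n)
       else lpp_neg_conj N p q (turn_index N p q n)) \<and>
    turn_index N p q (Suc n) = turn_index N p q n + nat (partial_quotient x n)"
proof -
  have z: "complete_quotient x n > 1" "complete_quotient x n \<notin> \<int>" for n
    using complete_quotient_gt_1[OF assms(1,2)] complete_quotient_irrational[OF assms(1)]
      Ints_subset_Rats by blast+
  note left_run = lpp_left_run[OF _ z]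
  note right_run = lpp_right_run[OF _ z]
  show ?thesis
  proof (induction n)
    case 0
    show ?case using left_run(1)[of 0 0] assms(3) by (simp add: partial_quotient_def)
  next
    case (Suc n)
    show ?case
    proof (cases "even n")
      case True
      then have w: "1 / lpp_neg_conj N p q (turn_index N p q (Suc n))
          = complete_quotient x n - of_int \<lfloor>complete_quotient x n\<rfloor>"
        using Suc left_run(2)[of "turn_index N p q n" n] by (simp add: partial_quotient_def)
      have "complete_quotient x (Suc n) = lpp_neg_conj N p q (turn_index N p q (Suc n))"
        by (simp del: turn_index.simps flip: w)
      with True right_run(1)[of "turn_index N p q (Suc n)" "Suc n"] show ?thesis
        by (simp add: partial_quotient_def turn_index.simps(2)[of _ _ _ "Suc n"]
            del: turn_index.simps complete_quotient.simps)
    next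
      case False
      then have "lpp_neg_conj N p q (turn_index N p q (Suc n))
          = complete_quotient x n - of_int \<lfloor>complete_quotient x n\<rfloor>"
        using Suc right_run(2)[of "turn_index N p q n" n] by (simp add: partial_quotient_def)
      then have "complete_quotient x (Suc n) = 1 / lpp_neg_conj N p q (turn_index N p q (Suc n))"
        by (simp del: turn_index.simps)
      with False left_run(1)[of "turn_index N p q (Suc n)" "Suc n"] show ?thesis
        by (simp add: partial_quotient_def turn_index.simps(2)[of _ _ _ "Suc n"]
            del: turn_index.simps complete_quotient.simps)
    qed
  qed
qed

section \<open>The value of w at the root of the path\<close>

text \<open>
  With \<open>e = (N - p\<^sup>2) / q\<close> the conjugate of \<open>x\<close> is \<open>- (\<surd>N - p) / e\<close>. The sum of the roots being
  rational gives \<open>x = (\<surd>N - p) / e - r\<close>, and then the coefficient of \<open>\<surd>N\<close> in their rational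
  product forces \<open>r = - 2 p / e\<close>.
\<close>

lemma conj_of_neg_inverse_quad_conj:
  assumes irr: "x \<notin> \<rat>"
    and quad: "a \<noteq> 0" "of_int a * x\<^sup>2 + of_int b * x + of_int c = 0"
    and \<alpha>: "(sqrt (of_int N) + of_int p) / of_int q = - 1 / quad_conj x"
  shows "x = of_int q / (sqrt (of_int N) - of_int p)"
proof -
  define s where "s = sqrt (real_of_int N)"
  obtain e where e: "N - p\<^sup>2 = q * e" using q_dvd by blast
  have e_pos: "e > 0" using e p_sq q_pos by (metis diff_gt_0_iff_gt zero_less_mult_pos)
  have "\<bar>of_int p\<bar> < s"
    using p_sq unfolding s_def by (simp only: abs_less_sqrt_iff)
  then have nz: "s + of_int p \<noteq> 0" "s - of_int p \<noteq> 0" by auto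
  have s_sq: "s * s = of_int N" using N_pos by (simp add: s_def)
  have real_e: "(s + of_int p) * (s - of_int p) = of_int q * of_int e"
    using arg_cong[OF e, of real_of_int] s_sq by (simp add: power2_eq_square algebra_simps)
  define y where "y = quad_conj x"
  have y: "y = - (of_int b / of_int a) - x"
    unfolding y_def by (rule quad_conj_eq[OF irr quad])
  have "(s + of_int p) / of_int q \<noteq> 0" using nz q_pos by simp
  \<comment> \<open>At y = 0 the right-hand side \<open>- 1 / y\<close> would be 0, but the root
    label is not.\<close>
  then have "y \<noteq> 0" using \<alpha> by (auto simp: y_def s_def)
  then have "y = - of_int q / (s + of_int p)"
    using \<alpha> nz q_pos by (simp add: y_def s_def field_simps)
  also have "\<dots> = - (s - of_int p) / of_int e"
    using real_e nz e_pos by (simp add: field_simps)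
  finally have y': "y = - (s - of_int p) / of_int e" .
  \<comment> \<open>By Vieta, the roots x and y have product k and sum - r.\<close>
  define k where "k = real_of_int c / of_int a"
  define r where "r = real_of_int b / of_int a"
  have "x * y = k"
    using quad unfolding y k_def by (simp add: field_simps power2_eq_square)
  moreover have x: "x = (s - of_int p) / of_int e - r"
    using y unfolding y' r_def minus_divide_left[symmetric] by linarith
  ultimately have prod: "((s - of_int p) / of_int e - r) * (s - of_int p) = - k * of_int e"
    using y' e_pos by (simp add: field_simps)
  \<comment> \<open>Replacing s * s by N leaves an equation linear in s, with rational
    coefficients.\<close>
  have "of_int N + of_int (p\<^sup>2) - 2 * of_int p * s - r * of_int e * s + r * of_int e * of_int p
      = - k * of_int e * of_int e"
    using prod e_pos s_sq by (simp add: field_simps power2_eq_square)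
  then have lin: "(2 * of_int p + r * of_int e) * s
      = of_int N + of_int (p\<^sup>2) + r * of_int e * of_int p + k * of_int e * of_int e"
    by (simp add: algebra_simps)
  have rats: "r \<in> \<rat>" "k \<in> \<rat>" by (simp_all add: r_def k_def)
  have "2 * of_int p + r * of_int e = 0"
  proof (rule ccontr)
    assume "2 * of_int p + r * of_int e \<noteq> 0"
    then have "s = (of_int N + of_int (p\<^sup>2) + r * of_int e * of_int p + k * of_int e * of_int e)
        / (2 * of_int p + r * of_int e)"
      using lin by (metis nonzero_mult_div_cancel_left)
    moreover have "\<dots> \<in> \<rat>"
      using rats by (intro Rats_divide Rats_add Rats_mult) simp_all
    ultimately show False
      using sqrt_nonsquare_irrational[OF N_pos nonsquare] by (simp add: s_def)
  qed
  then have "x = (s + of_int p) / of_int e"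
    using x e_pos by (simp add: field_simps)
  also have "\<dots> = of_int q / (s - of_int p)"
    using real_e nz e_pos by (simp add: field_simps)
  finally show ?thesis by (simp add: s_def)
qed

end

theorem proposition7:
  fixes x \<alpha> :: real and N p q :: int
  assumes "reduced_quadratic_surd x"
    and "\<alpha> = - 1 / quad_conj x"
    and "\<alpha> = (sqrt (of_int N) + of_int p) / of_int q"
    and "N > 0" and "\<not> is_square N"
    and "p > 0" and "p\<^sup>2 < N"
    and "q > 0" and "q dvd N - p\<^sup>2"
    and "(p - q)\<^sup>2 < N" and "N < (p + q)\<^sup>2"
  shows "\<forall>n.
    complete_quotient x n =
      (if even n then - 1 / surd_conj N (turn_value N p q n)
       else - surd_conj N (turn_value N p q n)) \<and>
    partial_quotient x n = turn_count N p q n"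
proof
  fix n
  interpret lpp_root N p q by unfold_locales fact+
  obtain a b c :: int where irr: "x \<notin> \<rat>" and gt: "x > 1"
    and quad: "a \<noteq> 0" "of_int a * x\<^sup>2 + of_int b * x + of_int c = 0"
    using assms(1) unfolding reduced_quadratic_surd_def by blast
  have "(sqrt (of_int N) + of_int p) / of_int q = - 1 / quad_conj x"
    using assms(2,3) by simp
  \<comment> \<open>Here the two notions of conjugate meet: \<open>quad_conj\<close> relates
    \<alpha> to x, while the path is measured by \<open>surd_conj\<close>. Together they give the
    starting value w = 1 / x.\<close>
  note conj_of_neg_inverse_quad_conj[OF irr quad this]
  moreover have "lpp_neg_conj N p q 0 = (sqrt (of_int N) - of_int p) / of_int q"
    by (rule lpp_neg_conj_eq) (simp add: lpp_label_def)
  ultimately have "1 / lpp_neg_conj N p q 0 = x" by simp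
  note main = lpp_complete_quotient[OF irr gt this, of n]
  \<comment> \<open>Needed to drop \<open>nat\<close> from the run length, since
    \<open>turn_count\<close> is an integer.\<close>
  have "partial_quotient x n \<ge> 0"
    using complete_quotient_gt_1[OF irr gt, of n] by (simp add: partial_quotient_def)
  with main have "partial_quotient x n = turn_count N p q n"
    unfolding turn_count_def by (simp del: turn_index.simps)
  with main show "complete_quotient x n =
      (if even n then - 1 / surd_conj N (turn_value N p q n)
       else - surd_conj N (turn_value N p q n)) \<and>
    partial_quotient x n = turn_count N p q n"
    by (simp add: lpp_neg_conj_def turn_value_def)
qed

end
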